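(* Let $p\ge 5$ be a prime. There does not exist a $(8p^3,\,4p^2+2p+1,\,2p+4,\,2p+2)$-PDS in an Abelian group.
   Context: Let $G$ be a finite Abelian group of order $v$ with identity $e$, and $D\subseteq G$ a subset of size $k$. $D$ is a $(v,k,\lambda,\mu)$-partial difference set (PDS) in $G$ if the expressions $gh^{-1}$ with $g,h\in D$, $g\neq h$, represent each non-identity element of $D$ exactly $\lambda$ times and each non-identity element of $G$ not in $D$ exactly $\mu$ times. Throughout the paper all PDS considered are regular: $D^{(-1)}=D$ and $e\notin D$. *)

theory Defs
  imports "HOL-Algebra.Coset" "HOL-Computational_Algebra.Primes"
begin

definition diff_reps :: "('a, 'b) monoid_scheme \<Rightarrow> 'a set \<Rightarrow> 'a \<Rightarrow> ('a \<times> 'a) set" where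
  "diff_reps G D x = {(g, h). g \<in> D \<and> h \<in> D \<and> g \<noteq> h \<and> g \<otimes>\<^bsub>G\<^esub> inv\<^bsub>G\<^esub> h = x}"

definition partial_difference_set ::
  "('a, 'b) monoid_scheme \<Rightarrow> nat \<Rightarrow> nat \<Rightarrow> nat \<Rightarrow> nat \<Rightarrow> 'a set \<Rightarrow> bool" where
  "partial_difference_set G v k l m D \<longleftrightarrow>
     finite (carrier G) \<and> order G = v \<and>
     D \<subseteq> carrier G \<and> card D = k \<and>
     (\<forall>x \<in> D - {\<one>\<^bsub>G\<^esub>}. card (diff_reps G D x) = l) \<and>
     (\<forall>x \<in> carrier G - D - {\<one>\<^bsub>G\<^esub>}. card (diff_reps G D x) = m)"

definition regular_subset :: "('a, 'b) monoid_scheme \<Rightarrow> 'a set \<Rightarrow> bool" where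
  "regular_subset G D \<longleftrightarrow> (\<lambda>g. inv\<^bsub>G\<^esub> g) ` D = D \<and> \<one>\<^bsub>G\<^esub> \<notin> D"

end

theory Submission
  imports Defs "HOL-Algebra.Sylow" "HOL-Number_Theory.Residue_Primitive_Roots"
begin

text \<open>In the integral group ring put E = D - 1; the parameters give E^2 = 4p^2 + (2p + 2) G, so
  every odd power of E is a multiple of E plus a multiple of G. Comparing the s-th power of E with
  the Frobenius congruence modulo a prime s gives two facts. If s does not divide 2p, then D is
  closed under x \<mapsto> x^s. If s = p, then the sum of E over the p-th roots of any element is divisible
  by p.

  Let C(a) be the sum of E over the fibre of x \<mapsto> x^(p^3) above a; there are 8 fibres, each of size
  p^3. Then p divides C(a), and the sums of C and of C^2 show that the eight integers
  2 C(a)/p - p, all odd, have squares adding up to 16. On the other hand, for a \<noteq> 1 the number C(a)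
  counts the elements of D in the fibre. A power map of order p - 1 permutes these and acts freely
  away from the at most one element of order dividing 8, so C(a) is 0 or 1 modulo p - 1. For p \<ge> 5 this
  excludes 2 C(a)/p - p = 1 and = -1, so the squares add up to at least 7 * 9.\<close>

section \<open>Cyclic actions, rotations and convolution powers\<close>

text \<open>Removing one orbit removes \<open>n\<close> equal weights and leaves an invariant set,
  so induction on subsets applies. The weights allow two uses: products along tuples, and plain
  cardinalities with weight 1.\<close>

lemma dvd_sum_free_orbits:
  fixes w :: "'a \<Rightarrow> int"
  assumes "finite X" and "n > 0"
    and "\<And>x. x \<in> X \<Longrightarrow> f x \<in> X"
    and "\<And>x. x \<in> X \<Longrightarrow> (f ^^ n) x = x"
    and "\<And>x i. x \<in> X \<Longrightarrow> 0 < i \<Longrightarrow> i < n \<Longrightarrow> (f ^^ i) x \<noteq> x"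
    and "\<And>x. x \<in> X \<Longrightarrow> w (f x) = w x"
  shows "int n dvd (\<Sum>x\<in>X. w x)"
  using assms
proof (induction X rule: finite_psubset_induct)
  case (psubset X)
  show ?case
  proof (cases "X = {}")
    case False
    then obtain x where x: "x \<in> X" by blast
    define Q where "Q = (\<lambda>i. (f ^^ i) x) ` {..<n}"
    have it: "(f ^^ i) x \<in> X" "w ((f ^^ i) x) = w x" for i
      by (induction i) (use x psubset.prems in auto)
    have inj: "inj_on (\<lambda>i. (f ^^ i) x) {..<n}"
    proof (rule linorder_inj_onI)
      fix i j assume ij: "i < j" "i \<in> {..<n}" "j \<in> {..<n}"
      show "(f ^^ i) x \<noteq> (f ^^ j) x"
      proof
        assume "(f ^^ i) x = (f ^^ j) x"
        moreover have "(f ^^ j) x = (f ^^ (j - i)) ((f ^^ i) x)"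
          using ij by (metis comp_apply funpow_add le_add_diff_inverse2 less_imp_le)
        ultimately show False
          using psubset.prems(4)[OF it(1)[of i], of "j - i"] ij
          by (simp add: less_imp_diff_less)
      qed
    qed auto
    have QX: "Q \<subseteq> X" using it by (auto simp: Q_def)
    have sumQ: "(\<Sum>y\<in>Q. w y) = int n * w x"
      unfolding Q_def by (subst sum.reindex[OF inj]) (simp add: it)
    \<comment> \<open>On \<open>X\<close> the map \<open>f\<close> is inverted by
      \<open>f ^^ (n - 1)\<close>, so the predecessor of an orbit element is again in the orbit. The
      predecessor of \<open>x\<close> itself has index \<open>n - 1\<close>.\<close>
    have "f z \<notin> Q" if z: "z \<in> X - Q" for z
    proof
      assume "f z \<in> Q"
      then obtain i where i: "i < n" "f z = (f ^^ i) x" by (auto simp: Q_def)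
      have "z = (f ^^ (n - 1)) (f z)"
        using psubset.prems(3)[of z] z \<open>n > 0\<close>
        by (metis DiffD1 Suc_diff_1 comp_apply funpow_Suc_right)
      also have "\<dots> = (f ^^ (n - 1 + i)) x" by (simp add: i funpow_add)
      finally have z': "z = (f ^^ (n - 1 + i)) x" .
      show False
      proof (cases i)
        case 0
        then show False using z z' \<open>n > 0\<close> by (auto simp: Q_def)
      next
        case (Suc j)
        then have "n - 1 + i = j + n" using \<open>n > 0\<close> by simp
        then have "z = (f ^^ j) x"
          using z' psubset.prems(3)[OF x] by (simp add: funpow_add)
        then show False using z Suc i by (auto simp: Q_def)
      qed
    qed
    moreover have "x \<in> Q" unfolding Q_def using \<open>n > 0\<close> by (auto intro!: image_eqI[of _ _ 0])
    ultimately have "int n dvd (\<Sum>y\<in>X - Q. w y)"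
      using psubset.prems x by (intro psubset.IH) auto
    moreover have "(\<Sum>y\<in>X. w y) = (\<Sum>y\<in>X - Q. w y) + (\<Sum>y\<in>Q. w y)"
      using QX psubset.hyps by (simp add: sum.subset_diff)
    ultimately show ?thesis by (simp add: sumQ)
  qed auto
qed

text \<open>Since \<open>i\<close> is invertible modulo the length, its multiples give every
  rotation. Hence all rotations fix \<open>xs\<close>, and each entry is the head of one of
  them.\<close>

lemma rotate_coprime_eq_replicate:
  assumes "rotate i xs = xs" and "coprime i (length xs)" and "xs \<noteq> []"
  shows "xs = replicate (length xs) (hd xs)"
proof -
  let ?n = "length xs"
  have "rotate (j * i) xs = xs" for j
    by (induction j) (simp_all add: assms(1) flip: rotate_rotate)
  have "xs ! k = hd xs" if "k < ?n" for k
  proof -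
    obtain j where "[i * j = 1] (mod ?n)"
      using cong_solve_coprime_nat[OF assms(2)] by auto
    then have "[k * (i * j) = k * 1] (mod ?n)" by (rule cong_scalar_left)
    then have "(k * j * i) mod ?n = k"
      using that by (simp add: cong_def mult_ac)
    then have "hd (rotate (k * j * i) xs) = xs ! k"
      using \<open>xs \<noteq> []\<close> by (simp add: hd_rotate_conv_nth)
    then show ?thesis by (simp add: \<open>\<And>j. rotate (j * i) xs = xs\<close>)
  qed
  then show ?thesis by (intro nth_equalityI) auto
qed

text \<open>The coefficient of \<open>y\<close> in the n-th power of the integral group ring element
  with coefficients \<open>f\<close>; group ring elements are represented by their coefficient
  functions.\<close>

primrec conv_power :: "('a, 'b) monoid_scheme \<Rightarrow> ('a \<Rightarrow> int) \<Rightarrow> nat \<Rightarrow> 'a \<Rightarrow> int" where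
  "conv_power G f 0 y = (if y = \<one>\<^bsub>G\<^esub> then 1 else 0)"
| "conv_power G f (Suc n) y = (\<Sum>x\<in>carrier G. f x * conv_power G f n (inv\<^bsub>G\<^esub> x \<otimes>\<^bsub>G\<^esub> y))"

section \<open>Fermat's theorem, the exponent of order p - 1, and the final inequality\<close>

lemma int_power_prime_cong:
  fixes a :: int
  assumes s: "Factorial_Ring.prime s"
  shows "[a ^ s = a] (mod int s)"
proof -
  have s0: "s > 0" using s prime_gt_0_nat by blast
  define c where "c = nat (a mod int s)"
  have c: "[int c = a] (mod int s)"
    using s0 by (simp add: c_def cong_def)
  have "[c ^ s = c] (mod s)"
  proof (cases "s dvd c")
    case True
    then show ?thesis using s0 dvd_trans[OF True dvd_power[of s c]] by (simp add: cong_def)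
  next
    case False
    then have "[c * c ^ (s - 1) = c * 1] (mod s)"
      using fermat_theorem[OF s] cong_scalar_left by blast
    then show ?thesis using s0 by (simp add: power_eq_if)
  qed
  then have "[int c ^ s = int c] (mod int s)"
    by (metis cong_int_iff of_nat_power)
  then show ?thesis
    using c by (meson cong_pow cong_sym cong_trans)
qed

text \<open>The exponent \<open>s\<close> is to fix elements of order dividing \<open>m\<close> and
  to act with exact order p - 1 on nontrivial elements of p-power order. Modulo \<open>p ^ 3\<close>
  it is a Teichmueller-type lift of a primitive root, glued to 1 modulo \<open>m\<close> by the
  Chinese remainder theorem.\<close>

lemma exists_multiplier:
  assumes p: "Factorial_Ring.prime p" and m: "coprime m p" "m > 1"
  shows "\<exists>s>0. [s = 1] (mod m) \<and> [s ^ (p - 1) = 1] (mod p ^ 3)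
      \<and> (\<forall>i. 0 < i \<and> i < p - 1 \<longrightarrow> \<not> [s ^ i = 1] (mod p))"
proof -
  obtain g where g: "residue_primroot p g"
    using prime_primitive_root_exists[OF prime_gt_1_nat[OF p] p] by blast
  then have ord: "Pocklington.ord p g = p - 1" and cop: "coprime p g"
    using p by (auto simp: residue_primroot_def totient_prime)
  \<comment> \<open>The unit group modulo \<open>p ^ 3\<close> has order p^2 (p - 1). The power p^2
    kills its p-part, while two uses of Fermat show that \<open>u\<close> is still \<open>g\<close>
    modulo \<open>p\<close>.\<close>
  define u where "u = g ^ (p ^ 2)"
  obtain s where s: "[s = 1] (mod m)" "[s = u] (mod p ^ 3)"
    using binary_chinese_remainder_nat[of m "p ^ 3" 1 u] m by auto
  have "[g ^ totient (p ^ 3) = 1] (mod p ^ 3)"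
    using cop by (intro euler_theorem) (simp add: coprime_commute)
  moreover have "totient (p ^ 3) = p ^ 2 * (p - 1)"
    using totient_prime_power[of p 3] p by (simp add: mult.commute)
  ultimately have "[u ^ (p - 1) = 1] (mod p ^ 3)"
    by (simp add: u_def flip: power_mult)
  then have 1: "[s ^ (p - 1) = 1] (mod p ^ 3)"
    using s(2) cong_pow cong_trans by blast
  have gp: "[g ^ p = g] (mod p)"
    using int_power_prime_cong[OF p, of "int g"] by (metis cong_int_iff of_nat_power)
  have "[s = u] (mod p)"
    using s(2) by (rule cong_dvd_modulus_nat) simp
  also have "u = (g ^ p) ^ p" by (simp add: u_def power2_eq_square power_mult)
  also have "[(g ^ p) ^ p = g] (mod p)"
    using gp cong_pow cong_trans by blast
  finally have sg: "[s = g] (mod p)" .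
  have 2: "\<not> [s ^ i = 1] (mod p)" if i: "0 < i" "i < p - 1" for i
  proof
    assume "[s ^ i = 1] (mod p)"
    then have "[g ^ i = 1] (mod p)"
      using sg cong_pow cong_sym cong_trans by blast
    then show False
      using ord i nat_dvd_not_less ord_divides by metis
  qed
  \<comment> \<open>As \<open>m > 1\<close>, the residue 1 modulo \<open>m\<close> rules out
    0.\<close>
  have "s > 0" using s(1) m(2) by (cases s) (auto simp: cong_def)
  then show ?thesis using s 1 2 by blast
qed

text \<open>Write p = 2h + 1 and N = pc. Modulo p - 1 = 2h, N is c, so c = h and c = h + 1 would
  leave a residue other than 0 and 1, as h \<ge> 2. These are the cases 2c - p = -1 and 1, so the
  odd number 2c - p has absolute value at least 3.\<close>

lemma odd_multiple_square_ge:
  fixes p N e :: int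
  assumes "odd p" "p \<ge> 5" "p dvd N" "p - 1 dvd N - e" "e \<in> {0, 1}"
  shows "(2 * N - p\<^sup>2)\<^sup>2 \<ge> 9 * p\<^sup>2"
proof -
  obtain h where h: "p = 2 * h + 1" using assms(1) by (auto elim: oddE)
  obtain c where c: "N = p * c" using assms(3) by auto
  have "c \<noteq> h"
  proof
    assume "c = h"
    then have "N - e = 2 * h * h + (h - e)" by (simp add: c h algebra_simps)
    then have "2 * h dvd h - e" using assms(4) h
      by (metis add_diff_cancel_right' dvd_add_right_iff dvd_triv_left)
    then show False using assms(2,5) h zdvd_imp_le[of "2 * h" "h - e"] by auto
  qed
  moreover have "c \<noteq> h + 1"
  proof
    assume "c = h + 1"
    then have "N - e = 2 * h * (h + 1) + (h + 1 - e)" by (simp add: c h algebra_simps)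
    then have "2 * h dvd h + 1 - e" using assms(4) h
      by (metis add_diff_cancel_right' dvd_add_right_iff dvd_triv_left)
    then show False using assms(2,5) h zdvd_imp_le[of "2 * h" "h + 1 - e"] by auto
  qed
  ultimately have "\<bar>2 * c - p\<bar> \<ge> 3" unfolding h by presburger
  then have "(2 * c - p)\<^sup>2 \<ge> 3\<^sup>2" using abs_le_square_iff[of 3 "2 * c - p"] by simp
  then have "p\<^sup>2 * (2 * c - p)\<^sup>2 \<ge> p\<^sup>2 * 9" by (intro mult_left_mono) auto
  moreover have "(2 * N - p\<^sup>2)\<^sup>2 = p\<^sup>2 * (2 * c - p)\<^sup>2"
    by (simp add: c power2_eq_square algebra_simps)
  ultimately show ?thesis by simp
qed

section \<open>The Frobenius congruence in the group ring\<close>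

context comm_group
begin

text \<open>These index the terms contributing to \<open>y\<close> when an n-th power is expanded.
  Unlike the recursive form of the power, they carry an action by rotation.\<close>

definition tuples :: "nat \<Rightarrow> 'a \<Rightarrow> 'a list set" where
  "tuples n y = {xs. set xs \<subseteq> carrier G \<and> length xs = n \<and> foldr (\<otimes>) xs \<one> = y}"

lemma foldr_mult_closed: "set xs \<subseteq> carrier G \<Longrightarrow> foldr (\<otimes>) xs \<one> \<in> carrier G"
  by (induction xs) auto

text \<open>Moving the last factor to the front uses commutativity; this is what makes the product
  of a tuple invariant under rotation.\<close>

lemma foldr_mult_snoc:
  assumes "set xs \<subseteq> carrier G" and "x \<in> carrier G"
  shows "foldr (\<otimes>) (xs @ [x]) \<one> = x \<otimes> foldr (\<otimes>) xs \<one>"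
  using assms
proof (induction xs)
  case (Cons a xs)
  then show ?case
    using m_lcomm[of a x "foldr (\<otimes>) xs \<one>"] by (simp add: foldr_mult_closed)
qed simp

lemma foldr_mult_replicate:
  "x \<in> carrier G \<Longrightarrow> foldr (\<otimes>) (replicate n x) \<one> = x [^] n"
  by (induction n) (simp_all add: m_comm)

lemma rotate1_tuples:
  assumes "xs \<in> tuples n y"
  shows "rotate1 xs \<in> tuples n y"
proof (cases xs)
  case (Cons a ys)
  then show ?thesis
    using assms foldr_mult_snoc[of ys a] by (auto simp: tuples_def)
qed (use assms in simp)

lemma finite_tuples: "finite (carrier G) \<Longrightarrow> finite (tuples n y)"
  unfolding tuples_def
  by (rule finite_subset[OF _ finite_lists_length_eq[of "carrier G" n]]) auto

lemma conv_power_eq_sum_tuples: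
  assumes "finite (carrier G)" and "y \<in> carrier G"
  shows "conv_power G f n y = (\<Sum>xs\<in>tuples n y. prod_list (map f xs))"
  using assms(2)
proof (induction n arbitrary: y)
  case 0
  have "tuples 0 y = (if y = \<one> then {[]} else {})" by (auto simp: tuples_def)
  then show ?case by simp
next
  case (Suc n)
  have eq: "tuples (Suc n) y = (\<Union>x\<in>carrier G. Cons x ` tuples n (inv x \<otimes> y))"
  proof (intro equalityI subsetI)
    fix xs assume "xs \<in> tuples (Suc n) y"
    then obtain x ys where xs: "xs = x # ys" and "x \<in> carrier G" "set ys \<subseteq> carrier G"
      "length ys = n" "x \<otimes> foldr (\<otimes>) ys \<one> = y"
      by (auto simp: tuples_def length_Suc_conv)
    then have "ys \<in> tuples n (inv x \<otimes> y)"
      using foldr_mult_closed[of ys] by (auto simp: tuples_def m_assoc[symmetric])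
    then show "xs \<in> (\<Union>x\<in>carrier G. Cons x ` tuples n (inv x \<otimes> y))"
      using xs \<open>x \<in> carrier G\<close> by blast
  next
    fix xs assume "xs \<in> (\<Union>x\<in>carrier G. Cons x ` tuples n (inv x \<otimes> y))"
    then show "xs \<in> tuples (Suc n) y"
      using Suc.prems by (auto simp: tuples_def m_assoc[symmetric])
  qed
  have "(\<Sum>xs\<in>tuples (Suc n) y. prod_list (map f xs))
      = (\<Sum>x\<in>carrier G. \<Sum>xs\<in>Cons x ` tuples n (inv x \<otimes> y). prod_list (map f xs))"
    unfolding eq using assms(1) by (subst sum.UNION_disjoint) (auto simp: finite_tuples)
  also have "\<dots> = (\<Sum>x\<in>carrier G. f x * conv_power G f n (inv x \<otimes> y))"
    using Suc by (intro sum.cong) (auto simp: sum.reindex sum_distrib_left)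
  finally show ?case by simp
qed

text \<open>Rotation acts freely on the non-constant tuples of prime length: this is the
  Frobenius congruence in the group ring.\<close>
lemma conv_power_prime_cong:
  assumes fin: "finite (carrier G)" and s: "Factorial_Ring.prime s" and y: "y \<in> carrier G"
  shows "[conv_power G f s y = (\<Sum>x | x \<in> carrier G \<and> x [^] s = y. f x ^ s)] (mod int s)"
proof -
  define X where "X = {x \<in> carrier G. x [^] s = y}"
  \<comment> \<open>The constant tuples, one for each s-th root of \<open>y\<close>; they account
    for the right-hand side.\<close>
  define R where "R = (\<lambda>x. replicate s x) ` X"
  have s0: "s > 0" using s prime_gt_0_nat by blast
  have RT: "R \<subseteq> tuples s y"
    by (auto simp: R_def X_def tuples_def foldr_mult_replicate simp del: foldr_replicate)
  have inj: "inj_on (\<lambda>x. replicate s x) X"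
    using s0 by (auto simp: inj_on_def)
  have sumR: "(\<Sum>xs\<in>R. prod_list (map f xs)) = (\<Sum>x\<in>X. f x ^ s)"
    unfolding R_def by (subst sum.reindex[OF inj]) (simp add: map_replicate prod_list_replicate)
  \<comment> \<open>Primality of \<open>s\<close> makes every proper shift coprime to the length, so
    a tuple with a nontrivial stabiliser is constant.\<close>
  have const: "xs \<in> R" if xs: "xs \<in> tuples s y" "rotate i xs = xs" "0 < i" "i < s" for xs i
  proof -
    have len: "length xs = s" using xs by (simp add: tuples_def)
    have "coprime i s"
      using s xs by (metis coprime_commute nat_dvd_not_less prime_imp_coprime)
    moreover have "xs \<noteq> []" using len s0 by auto
    ultimately have eq: "xs = replicate s (hd xs)"
      using rotate_coprime_eq_replicate[of i xs] xs len by simp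
    have "hd xs \<in> carrier G" using xs \<open>xs \<noteq> []\<close> hd_in_set unfolding tuples_def by blast
    moreover from this have "hd xs [^] s = y"
      using xs eq foldr_mult_replicate[of "hd xs" s] by (auto simp: tuples_def)
    ultimately show ?thesis using eq by (auto simp: R_def X_def)
  qed
  have "int s dvd (\<Sum>xs\<in>tuples s y - R. prod_list (map f xs))"
  proof (rule dvd_sum_free_orbits[where f = rotate1])
    fix xs assume xs: "xs \<in> tuples s y - R"
    then have len: "length xs = s" by (simp add: tuples_def)
    show "(rotate1 ^^ s) xs = xs"
      using len by (simp add: rotate_def[symmetric])
    show "(rotate1 ^^ i) xs \<noteq> xs" if "0 < i" "i < s" for i
      using const[of xs i] xs that by (auto simp: rotate_def)
    show "rotate1 xs \<in> tuples s y - R"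
    proof -
      have "rotate1 xs \<notin> R"
      proof
        assume "rotate1 xs \<in> R"
        then obtain x where "rotate1 xs = replicate s x" "x \<in> X" by (auto simp: R_def)
        then have "\<forall>z\<in>set xs. z = x" using set_rotate1[of xs] by (metis in_set_replicate)
        then have "xs = replicate s x" using len replicate_eqI by metis
        then show False using xs \<open>x \<in> X\<close> by (auto simp: R_def)
      qed
      then show ?thesis using rotate1_tuples xs by blast
    qed
    show "prod_list (map f (rotate1 xs)) = prod_list (map f xs)"
      by (cases xs) (simp_all add: mult.commute)
  qed (use fin s0 in \<open>auto simp: finite_tuples\<close>)
  moreover have "conv_power G f s y
      = (\<Sum>xs\<in>tuples s y - R. prod_list (map f xs)) + (\<Sum>xs\<in>R. prod_list (map f xs))"
    using RT fin y by (simp add: conv_power_eq_sum_tuples sum.subset_diff finite_tuples)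
  ultimately show ?thesis by (simp add: cong_iff_dvd_diff sumR X_def)
qed

section \<open>Odd powers of an element with square a + b G\<close>

lemma sum_translate:
  assumes "x \<in> carrier G"
  shows "(\<Sum>y\<in>carrier G. h (inv x \<otimes> y)) = (\<Sum>y\<in>carrier G. h y)"
  by (rule sum.reindex_bij_witness[of _ "\<lambda>y. x \<otimes> y" "\<lambda>y. inv x \<otimes> y"])
     (use assms in \<open>auto simp: m_assoc[symmetric]\<close>)

lemma sum_conv_power:
  "(\<Sum>y\<in>carrier G. conv_power G f n y) = (\<Sum>x\<in>carrier G. f x) ^ n"
  if fin: "finite (carrier G)"
proof (induction n)
  case 0
  then show ?case using fin by (simp add: sum.delta)
next
  case (Suc n)
  have "(\<Sum>y\<in>carrier G. conv_power G f (Suc n) y)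
      = (\<Sum>x\<in>carrier G. f x * (\<Sum>y\<in>carrier G. conv_power G f n (inv x \<otimes> y)))"
    by (simp add: sum_distrib_left) (rule sum.swap)
  also have "\<dots> = (\<Sum>x\<in>carrier G. f x * (\<Sum>x\<in>carrier G. f x) ^ n)"
    by (intro sum.cong refl) (simp add: sum_translate Suc.IH)
  finally show ?case by (simp add: sum_distrib_right)
qed

text \<open>By associativity f^(n+2) = f^2 f^n. The part a of f^2 scales f^n, and G f^n is constant,
  namely the coefficient sum of f^n.\<close>

lemma conv_power_Suc_Suc:
  assumes fin: "finite (carrier G)" and y: "y \<in> carrier G"
    and sq: "\<And>z. z \<in> carrier G \<Longrightarrow>
      (\<Sum>x\<in>carrier G. f x * f (inv x \<otimes> z)) = (if z = \<one> then a else 0) + b"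
  shows "conv_power G f (Suc (Suc n)) y
      = a * conv_power G f n y + b * (\<Sum>x\<in>carrier G. f x) ^ n"
proof -
  let ?L = "conv_power G f n"
  have conj: "inv y \<otimes> z \<otimes> y = z" if "z \<in> carrier G" for z
    using that y by (simp add: m_comm[of "inv y"] m_assoc)
  have "conv_power G f (Suc (Suc n)) y
      = (\<Sum>x\<in>carrier G. f x * (\<Sum>z\<in>carrier G. f z * ?L (inv z \<otimes> (inv x \<otimes> y))))"
    by simp
  \<comment> \<open>Translating the inner variable by \<open>x\<close> frees the last factor of
    \<open>x\<close>, so summing over \<open>x\<close> first produces the coefficient of f^2 at
    \<open>z\<close>.\<close>
  also have "\<dots> = (\<Sum>x\<in>carrier G. f x * (\<Sum>z\<in>carrier G. f (inv x \<otimes> z) * ?L (inv z \<otimes> y)))"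
  proof (rule sum.cong[OF refl])
    fix x assume x: "x \<in> carrier G"
    have "inv (inv x \<otimes> z) \<otimes> (inv x \<otimes> y) = inv z \<otimes> y" if "z \<in> carrier G" for z
    proof -
      have "x \<otimes> (inv x \<otimes> y) = y"
        using x y by (simp add: m_assoc[symmetric])
      then show ?thesis
        using x y that by (simp add: inv_mult_group m_assoc)
    qed
    then have "(\<Sum>z\<in>carrier G. f z * ?L (inv z \<otimes> (inv x \<otimes> y)))
        = (\<Sum>z\<in>carrier G. f (inv x \<otimes> z) * ?L (inv z \<otimes> y))"
      by (subst sum_translate[OF x, symmetric]) simp
    then show "f x * (\<Sum>z\<in>carrier G. f z * ?L (inv z \<otimes> (inv x \<otimes> y)))
        = f x * (\<Sum>z\<in>carrier G. f (inv x \<otimes> z) * ?L (inv z \<otimes> y))" by simp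
  qed
  also have "\<dots> = (\<Sum>z\<in>carrier G. (\<Sum>x\<in>carrier G. f x * f (inv x \<otimes> z)) * ?L (inv z \<otimes> y))"
    unfolding sum_distrib_left sum_distrib_right by (subst sum.swap) (simp add: mult.assoc)
  also have "\<dots> = (\<Sum>z\<in>carrier G. (if z = \<one> then a * ?L y else 0) + b * ?L (inv z \<otimes> y))"
    using y by (intro sum.cong refl) (auto simp: sq algebra_simps)
  also have "\<dots> = a * ?L y + b * (\<Sum>z\<in>carrier G. ?L (inv z \<otimes> y))"
    using fin by (simp add: sum.distrib sum.delta sum_distrib_left)
  also have "(\<Sum>z\<in>carrier G. ?L (inv z \<otimes> y)) = (\<Sum>z\<in>carrier G. ?L z)"
    by (rule sum.reindex_bij_witness[of _ "\<lambda>z. y \<otimes> inv z" "\<lambda>z. inv z \<otimes> y"])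
       (use y in \<open>auto simp: inv_mult_group m_assoc[symmetric] m_comm[of y] conj\<close>)
  finally show ?thesis using fin by (simp add: sum_conv_power)
qed

text \<open>Each multiplication by f^2 = a + b G scales the multiple of \<open>f\<close> by
  \<open>a\<close> and changes only the constant \<open>c\<close>. The increment contains an odd,
  hence positive, power of the coefficient sum, which preserves the divisibility of
  \<open>c\<close>.\<close>

lemma conv_power_odd:
  assumes fin: "finite (carrier G)"
    and sq: "\<And>z. z \<in> carrier G \<Longrightarrow>
      (\<Sum>x\<in>carrier G. f x * f (inv x \<otimes> z)) = (if z = \<one> then a else 0) + b"
  shows "\<exists>c. (\<Sum>x\<in>carrier G. f x) dvd c \<and>
      (\<forall>y\<in>carrier G. conv_power G f (2 * m + 1) y = a ^ m * f y + c)"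
proof (induction m)
  case 0
  have "conv_power G f 1 y = f y" if y: "y \<in> carrier G" for y
  proof -
    have "inv x \<otimes> y = \<one> \<longleftrightarrow> x = y" if "x \<in> carrier G" for x
      using y that by (metis inv_closed inv_equality inv_inv r_inv)
    then have "conv_power G f 1 y = (\<Sum>x\<in>carrier G. if x = y then f x else 0)"
      by (auto intro!: sum.cong)
    then show ?thesis using fin y by simp
  qed
  then show ?case by (intro exI[of _ 0]) auto
next
  case (Suc m)
  then obtain c where c: "(\<Sum>x\<in>carrier G. f x) dvd c"
    "\<And>y. y \<in> carrier G \<Longrightarrow> conv_power G f (2 * m + 1) y = a ^ m * f y + c" by blast
  have "conv_power G f (2 * Suc m + 1) y
      = a ^ Suc m * f y + (a * c + b * (\<Sum>x\<in>carrier G. f x) ^ (2 * m + 1))"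
    if "y \<in> carrier G" for y
    using conv_power_Suc_Suc[OF fin that sq, of "2 * m + 1"] c(2)[OF that]
    by (simp add: algebra_simps)
  moreover have "(\<Sum>x\<in>carrier G. f x) dvd a * c + b * (\<Sum>x\<in>carrier G. f x) ^ (2 * m + 1)"
    using c(1) by simp
  ultimately show ?case by blast
qed

section \<open>Power maps and multipliers\<close>

lemma nat_pow_coprime_eq_one:
  assumes "x \<in> carrier G" and "x [^] m = \<one>" and "x [^] n = \<one>" and "coprime m (n::nat)"
  shows "x = \<one>"
proof -
  have "ord x dvd m" "ord x dvd n"
    using assms by (simp_all add: pow_eq_id)
  then have "ord x = 1"
    using assms(4) coprime_common_divisor_nat by blast
  then show ?thesis using pow_ord_eq_1[OF assms(1)] assms(1) by simp
qed

lemma nat_pow_diff_eq_one: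
  assumes "x \<in> carrier G" "y \<in> carrier G" and "x [^] (n::nat) = y [^] n"
  shows "(x \<otimes> inv y) [^] n = \<one>"
  using assms by (simp add: nat_pow_distrib nat_pow_inv)

lemma nat_pow_coprime_inj:
  assumes "x \<in> carrier G" "y \<in> carrier G"
    and "x [^] (m::nat) = y [^] m" and "x [^] (n::nat) = y [^] n" and "coprime m n"
  shows "x = y"
proof -
  have "x \<otimes> inv y = \<one>"
    using assms by (intro nat_pow_coprime_eq_one[OF _ nat_pow_diff_eq_one nat_pow_diff_eq_one]) auto
  then show ?thesis using assms inv_equality by fastforce
qed

text \<open>Two evaluations of the s-th power are compared: the Frobenius congruence, with exponents
  removed by Fermat, and the formula for odd powers. The constant \<open>c\<close> is common to all
  \<open>y\<close>, which later allows it to be found at one point.\<close>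

lemma sum_roots_prime_cong:
  assumes fin: "finite (carrier G)"
    and sq: "\<And>z. z \<in> carrier G \<Longrightarrow>
      (\<Sum>x\<in>carrier G. f x * f (inv x \<otimes> z)) = (if z = \<one> then a else 0) + b"
    and s: "Factorial_Ring.prime s" "odd s"
  shows "\<exists>c. (\<Sum>x\<in>carrier G. f x) dvd c \<and> (\<forall>y\<in>carrier G.
      [(\<Sum>x | x \<in> carrier G \<and> x [^] s = y. f x) = a ^ ((s - 1) div 2) * f y + c] (mod int s))"
proof -
  obtain m where m: "s = 2 * m + 1" using s(2) oddE by blast
  obtain c where c: "(\<Sum>x\<in>carrier G. f x) dvd c"
    "\<And>y. y \<in> carrier G \<Longrightarrow> conv_power G f s y = a ^ m * f y + c"
    using conv_power_odd[OF fin sq, of m] unfolding m by blast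
  have "[(\<Sum>x | x \<in> carrier G \<and> x [^] s = y. f x) = a ^ ((s - 1) div 2) * f y + c] (mod int s)"
    if y: "y \<in> carrier G" for y
  proof -
    have "[(\<Sum>x | x \<in> carrier G \<and> x [^] s = y. f x ^ s)
        = (\<Sum>x | x \<in> carrier G \<and> x [^] s = y. f x)] (mod int s)"
      by (intro cong_sum int_power_prime_cong s)
    then show ?thesis
      using conv_power_prime_cong[OF fin s(1) y, of f] c(2)[OF y] m
      by (auto intro: cong_sym cong_trans)
  qed
  then show ?thesis using c(1) by blast
qed

text \<open>As \<open>s\<close> is prime to the group order, each sum over s-th roots has a single
  term. Since the constant in the square is itself \<open>r ^ 2\<close>, its power (s - 1)/2 is
  r^(s-1), which is 1 modulo \<open>s\<close>; for a general constant a sign could appear.\<close>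

lemma multiplier_prime_cong:
  assumes fin: "finite (carrier G)"
    and sq: "\<And>z. z \<in> carrier G \<Longrightarrow>
      (\<Sum>x\<in>carrier G. f x * f (inv x \<otimes> z)) = (if z = \<one> then r ^ 2 else 0) + b"
    and s: "Factorial_Ring.prime s" "odd s" "coprime s (order G)" "coprime (int s) r"
    and x: "x \<in> carrier G"
  shows "[f (x [^] s) = f x] (mod int s)"
proof -
  obtain c where c: "\<And>y. y \<in> carrier G \<Longrightarrow>
      [(\<Sum>x | x \<in> carrier G \<and> x [^] s = y. f x) = (r ^ 2) ^ ((s - 1) div 2) * f y + c] (mod int s)"
    using sum_roots_prime_cong[OF fin sq s(1,2)] by blast
  have r1: "[(r ^ 2) ^ ((s - 1) div 2) = 1] (mod int s)"
  proof -
    have "[r * r ^ (s - 1) = r * 1] (mod int s)"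
      using int_power_prime_cong[OF s(1), of r] prime_gt_0_nat[OF s(1)]
      by (simp add: power_eq_if)
    then have "[r ^ (s - 1) = 1] (mod int s)"
      using s(4) cong_mult_lcancel[of r "int s"] by (metis coprime_commute)
    then show ?thesis using s(2) by (simp flip: power_mult)
  qed
  have roots: "{z. z \<in> carrier G \<and> z [^] s = y [^] s} = {y}" if "y \<in> carrier G" for y
    using that s(3) nat_pow_coprime_inj[of _ y s "order G"] by (auto simp: pow_order_eq_1)
  have key: "[f y = f (y [^] s) + c] (mod int s)" if "y \<in> carrier G" for y
  proof -
    have "[(r ^ 2) ^ ((s - 1) div 2) * f (y [^] s) + c = 1 * f (y [^] s) + c] (mod int s)"
      by (intro cong_add cong_mult r1 cong_refl)
    then show ?thesis
      using c[of "y [^] s"] that roots[OF that] by (auto intro: cong_trans)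
  qed
  \<comment> \<open>The identity is its own s-th power, so the congruence there determines
    \<open>c\<close>.\<close>
  have "[c = 0] (mod int s)"
    using key[of \<one>] by (simp add: cong_iff_dvd_diff)
  then have "[f (x [^] s) + c = f (x [^] s) + 0] (mod int s)"
    by (intro cong_add cong_refl)
  then show ?thesis
    using key[OF x] by (auto intro: cong_sym cong_trans)
qed

section \<open>Partial difference sets in the group ring\<close>

text \<open>For \<open>\<lambda> = \<mu> + 2\<close>, subtracting the identity from \<open>D\<close> removes the linear term from its
  quadratic equation in the group ring.\<close>
definition pds_elem :: "'a set \<Rightarrow> 'a \<Rightarrow> int" where
  "pds_elem D x = of_bool (x \<in> D) - of_bool (x = \<one>)"

text \<open>Counting differences gives D^2 = (k - m) + 2 D + m G. Expanding (D - 1)^2 subtracts 2 D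
  and adds 1.\<close>

lemma pds_elem_square:
  assumes pds: "partial_difference_set G v k (m + 2) m D" and reg: "regular_subset G D"
    and z: "z \<in> carrier G"
  shows "(\<Sum>x\<in>carrier G. pds_elem D x * pds_elem D (inv x \<otimes> z))
      = (if z = \<one> then int k + 1 - int m else 0) + int m"
proof -
  have fin: "finite (carrier G)" and DG: "D \<subseteq> carrier G" and card: "card D = k"
    using pds by (auto simp: partial_difference_set_def)
  have one: "\<one> \<notin> D" and invD: "\<And>x. x \<in> D \<Longrightarrow> inv x \<in> D"
    using reg by (auto simp: regular_subset_def)
  have eq1: "inv x \<otimes> z = \<one> \<longleftrightarrow> x = z" if "x \<in> carrier G" for x
    using z that by (metis inv_closed inv_equality inv_inv r_inv)
  define T where "T = {x \<in> carrier G. x \<in> D \<and> inv x \<otimes> z \<in> D}"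
  have "(\<Sum>x\<in>carrier G. pds_elem D x * pds_elem D (inv x \<otimes> z))
      = (\<Sum>x\<in>carrier G. of_bool (x \<in> D \<and> inv x \<otimes> z \<in> D)
          - (if x = z then of_bool (z \<in> D) else 0)
          - (if x = \<one> then of_bool (z \<in> D) else 0)
          + (if x = \<one> then of_bool (z = \<one>) else 0))"
    using z by (intro sum.cong refl) (auto simp: pds_elem_def eq1)
  also have "\<dots> = int (card T) - 2 * of_bool (z \<in> D) + of_bool (z = \<one>)"
    using fin z by (simp add: sum.distrib sum_subtractf T_def Int_def)
  finally have sum: "(\<Sum>x\<in>carrier G. pds_elem D x * pds_elem D (inv x \<otimes> z))
      = int (card T) - 2 * of_bool (z \<in> D) + of_bool (z = \<one>)" .
  show ?thesis
  proof (cases "z = \<one>")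
    case True
    then have "T = D" using DG invD by (auto simp: T_def)
    then show ?thesis using sum True one card by simp
  next
    case False
    have zx: "x \<otimes> inv (inv z \<otimes> x) = z" "inv (inv z \<otimes> x) = inv x \<otimes> z"
      if "x \<in> carrier G" for x
      using that z m_comm[of z "inv x"] by (simp_all add: inv_mult_group m_assoc[symmetric])
    have hx: "h = inv z \<otimes> x" if "x \<in> carrier G" "h \<in> carrier G" "x \<otimes> inv h = z" for x h
      using that by (metis inv_closed inv_inv inv_mult_group l_inv m_assoc m_closed r_one)
    \<comment> \<open>A quotient x h^-1 = z forces h = z^-1 x, and h lies in \<open>D\<close>
      exactly when its inverse x^-1 z does. Thus products in \<open>D\<close> equal to
      \<open>z\<close> match differences equal to \<open>z\<close>.\<close>
    have "bij_betw (\<lambda>x. (x, inv z \<otimes> x)) T (diff_reps G D z)"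
    proof (rule bij_betwI[where g = fst])
      show "(\<lambda>x. (x, inv z \<otimes> x)) \<in> T \<rightarrow> diff_reps G D z"
      proof
        fix x assume x: "x \<in> T"
        then have "inv (inv x \<otimes> z) \<in> D" using invD by (auto simp: T_def)
        moreover have "inv (inv x \<otimes> z) = inv z \<otimes> x"
          using x z by (simp add: T_def inv_mult_group)
        moreover have "x \<noteq> inv z \<otimes> x"
          using zx(1)[of x] x False by (auto simp: T_def)
        ultimately show "(x, inv z \<otimes> x) \<in> diff_reps G D z"
          using x zx(1)[of x] by (auto simp: diff_reps_def T_def)
      qed
      show "fst \<in> diff_reps G D z \<rightarrow> T"
      proof
        fix g assume "g \<in> diff_reps G D z"
        then obtain x h where g: "g = (x, h)" "x \<in> D" "h \<in> D" "x \<otimes> inv h = z"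
          by (auto simp: diff_reps_def)
        then have "x \<in> carrier G" "h = inv z \<otimes> x" using DG hx[of x h] by auto
        then have "inv x \<otimes> z \<in> D" using g zx(2)[of x] invD[of h] by simp
        then show "fst g \<in> T" using g \<open>x \<in> carrier G\<close> by (simp add: T_def)
      qed
      show "(fst g, inv z \<otimes> fst g) = g" if "g \<in> diff_reps G D z" for g
        using that DG hx[of "fst g" "snd g", symmetric] by (fastforce simp: diff_reps_def)
    qed auto
    then have "card T = card (diff_reps G D z)" by (rule bij_betw_same_card)
    then show ?thesis
      using sum False pds z by (cases "z \<in> D") (auto simp: partial_difference_set_def)
  qed
qed

lemma sum_pds_elem:
  assumes "partial_difference_set G v k l m D" "X \<subseteq> carrier G"
  shows "(\<Sum>x\<in>X. pds_elem D x) = int (card (D \<inter> X)) - of_bool (\<one> \<in> X)"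
proof -
  have "finite X"
    using assms finite_subset by (auto simp: partial_difference_set_def)
  then show ?thesis
    by (simp add: pds_elem_def sum_subtractf Int_commute[of D])
qed

text \<open>Peel off prime factors of \<open>s\<close> one at a time. Each prime factor q is odd, so
  q \<ge> 3, and coefficients of D - 1 lie in {-1, 0, 1}; one congruent to 1 modulo q is therefore
  equal to 1.\<close>

lemma pds_pow_closed:
  assumes pds: "partial_difference_set G v k (m + 2) m D" and reg: "regular_subset G D"
    and r: "int k + 1 - int m = r ^ 2"
    and s: "s > 0" "coprime s (2 * order G)" "coprime (int s) r"
    and x: "x \<in> D"
  shows "x [^] s \<in> D"
  using s x
proof (induction s arbitrary: x rule: less_induct)
  case (less s)
  have fin: "finite (carrier G)" and DG: "D \<subseteq> carrier G"
    using pds by (auto simp: partial_difference_set_def)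
  have one: "\<one> \<notin> D" using reg by (auto simp: regular_subset_def)
  show ?case
  proof (cases "s = 1")
    case True
    then show ?thesis using less.prems DG by auto
  next
    case False
    then obtain q where q: "Factorial_Ring.prime q" "q dvd s"
      using prime_factor_nat by blast
    then obtain t where t: "s = q * t" by auto
    have cq: "coprime q 2" "coprime q (order G)" "coprime (int q) r"
      using less.prems t by auto
    have "coprime t (2 * order G)" "coprime (int t) r" "t > 0" "t < s"
      using less.prems t prime_gt_1_nat[OF q(1)] by auto
    then have xt: "x [^] t \<in> D" using less by blast
    have "odd q" using cq(1) by simp
    then have q3: "q \<ge> 3" using prime_ge_2_nat[OF q(1)] by (cases "q = 2") auto
    have "[pds_elem D ((x [^] t) [^] q) = pds_elem D (x [^] t)] (mod int q)"
      using multiplier_prime_cong[OF fin _ q(1) \<open>odd q\<close> cq(2,3), of "pds_elem D" "int m" "x [^] t"]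
        pds_elem_square[OF pds reg] r xt DG by auto
    moreover have "pds_elem D (x [^] t) = 1"
      using xt one by (auto simp: pds_elem_def)
    ultimately have "int q dvd pds_elem D ((x [^] t) [^] q) - 1"
      by (simp add: cong_iff_dvd_diff)
    then have "(x [^] t) [^] q \<in> D"
      using q3 zdvd_imp_le[of "int q" 1] zdvd_imp_le[of "int q" 2]
      by (auto simp: pds_elem_def of_bool_def split: if_splits)
    then show ?thesis
      using less.prems DG t by (auto simp: nat_pow_pow mult.commute)
  qed
qed

section \<open>Fibres of power maps\<close>

abbreviation roots :: "nat \<Rightarrow> 'a \<Rightarrow> 'a set" where
  "roots n a \<equiv> {x. x \<in> carrier G \<and> x [^] n = a}"

text \<open>The parametrisation z^-1 x is chosen because its inverse x^-1 z is the argument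
  occurring in a convolution.\<close>

lemma bij_betw_roots:
  assumes x: "x \<in> carrier G"
  shows "bij_betw (\<lambda>z. inv z \<otimes> x) (roots n \<one>) (roots n (x [^] n))"
proof (rule bij_betwI[where g = "\<lambda>y. x \<otimes> inv y"])
  show "(\<lambda>z. inv z \<otimes> x) \<in> roots n \<one> \<rightarrow> roots n (x [^] n)"
    using x by (auto simp: nat_pow_distrib nat_pow_inv)
  show "(\<lambda>y. x \<otimes> inv y) \<in> roots n (x [^] n) \<rightarrow> roots n \<one>"
    using x by (auto simp: nat_pow_distrib nat_pow_inv)
  show "x \<otimes> inv (inv z \<otimes> x) = z" if "z \<in> roots n \<one>" for z
    using x that by (simp add: inv_mult_group m_assoc[symmetric])
  show "inv (x \<otimes> inv y) \<otimes> x = y" if "y \<in> roots n (x [^] n)" for y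
    using x that by (simp add: inv_mult_group m_assoc)
qed

lemma card_pow_image_kernel:
  assumes fin: "finite (carrier G)"
  shows "card ((\<lambda>x. x [^] n) ` carrier G) * card (roots n \<one>) = order G"
proof -
  have "order G = (\<Sum>a\<in>(\<lambda>x. x [^] n) ` carrier G. \<Sum>x\<in>roots n a. 1)"
    using fin by (subst sum.group) (auto simp: order_def)
  also have "\<dots> = (\<Sum>a\<in>(\<lambda>x. x [^] n) ` carrier G. card (roots n \<one>))"
    using bij_betw_same_card[OF bij_betw_roots] by (intro sum.cong) auto
  finally show ?thesis by simp
qed

lemma subgroup_pow_card:
  assumes "subgroup H G" "finite (carrier G)" "x \<in> H"
  shows "x [^] card H = \<one>"
proof -
  interpret H: group "G\<lparr>carrier := H\<rparr>"
    using assms subgroup_imp_group by blast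
  show ?thesis
    using H.pow_order_eq_1[of x] assms by (simp add: order_def nat_pow_consistent[symmetric])
qed

text \<open>Sylow subgroups bound both cardinalities from below: the one of order
  \<open>p ^ b\<close> lies in the kernel, the one of order \<open>q ^ a\<close> embeds in the
  image. The product of the two cardinalities is the group order, so both bounds are
  attained.\<close>

lemma card_pow_prime_power:
  assumes fin: "finite (carrier G)" and ord: "order G = q ^ a * p ^ b"
    and p: "Factorial_Ring.prime p" and q: "Factorial_Ring.prime q" and "p \<noteq> q"
  shows "card ((\<lambda>x. x [^] (p ^ b)) ` carrier G) = q ^ a" "card (roots (p ^ b) \<one>) = p ^ b"
proof -
  let ?A = "(\<lambda>x. x [^] (p ^ b)) ` carrier G"
  have grp: "group G" by (rule group_axioms)
  obtain P where P: "subgroup P G" "card P = p ^ b"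
    using sylow_thm[OF p grp _ fin, of b "q ^ a"] ord by (auto simp: mult.commute)
  obtain H where H: "subgroup H G" "card H = q ^ a"
    using sylow_thm[OF q grp _ fin, of a "p ^ b"] ord by auto
  have HG: "H \<subseteq> carrier G" and PG: "P \<subseteq> carrier G"
    using H P subgroup.subset by auto
  have "P \<subseteq> roots (p ^ b) \<one>"
    using subgroup_pow_card[OF P(1) fin] P PG by auto
  then have 1: "p ^ b \<le> card (roots (p ^ b) \<one>)"
    using P fin card_mono[of "roots (p ^ b) \<one>" P] by simp
  have cop: "coprime (q ^ a) (p ^ b)"
    using p q \<open>p \<noteq> q\<close> by (simp add: primes_coprime)
  have "inj_on (\<lambda>x. x [^] (p ^ b)) H"
  proof (rule inj_onI)
    fix x y assume "x \<in> H" "y \<in> H" "x [^] (p ^ b) = y [^] (p ^ b)"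
    then show "x = y"
      using nat_pow_coprime_inj[OF _ _ _ _ cop, of x y] subgroup_pow_card[OF H(1) fin] H HG by auto
  qed
  then have 2: "q ^ a \<le> card ?A"
    using H fin HG card_mono[of ?A "(\<lambda>x. x [^] (p ^ b)) ` H"] by (simp add: card_image image_mono)
  have eq: "card ?A * card (roots (p ^ b) \<one>) = q ^ a * p ^ b"
    using card_pow_image_kernel[OF fin] ord by simp
  have pos: "p ^ b > 0" "q ^ a > 0" using p q prime_gt_0_nat by auto
  have "card ?A * p ^ b \<le> q ^ a * p ^ b"
    using eq mult_le_mono2[OF 1, of "card ?A"] by simp
  then have "card ?A \<le> q ^ a" using pos(1) mult_le_cancel2 by blast
  then show A: "card ?A = q ^ a" using 2 by (rule antisym)
  show "card (roots (p ^ b) \<one>) = p ^ b" using eq A pos(2) by (metis mult_left_cancel less_not_refl)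
qed

text \<open>The left side sums f(x) f(y) over pairs in a common fibre, that is, with y = z^-1 x for
  z in the kernel. Symmetry of \<open>f\<close> turns this into the coefficients of f^2 summed over
  the kernel.\<close>

lemma sum_roots_squares:
  assumes fin: "finite (carrier G)"
    and sq: "\<And>z. z \<in> carrier G \<Longrightarrow>
      (\<Sum>x\<in>carrier G. f x * f (inv x \<otimes> z)) = (if z = \<one> then a else 0) + b"
    and sym: "\<And>x. x \<in> carrier G \<Longrightarrow> f (inv x) = f x"
  shows "(\<Sum>c\<in>(\<lambda>x. x [^] (n::nat)) ` carrier G. (\<Sum>x\<in>roots n c. f x)\<^sup>2)
      = a + b * int (card (roots n \<one>))"
proof -
  have "(\<Sum>c\<in>(\<lambda>x. x [^] n) ` carrier G. (\<Sum>x\<in>roots n c. f x)\<^sup>2)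
      = (\<Sum>c\<in>(\<lambda>x. x [^] n) ` carrier G. \<Sum>x\<in>roots n c. f x * (\<Sum>y\<in>roots n (x [^] n). f y))"
    by (simp add: power2_eq_square sum_distrib_right)
  also have "\<dots> = (\<Sum>x\<in>carrier G. f x * (\<Sum>y\<in>roots n (x [^] n). f y))"
    using fin by (intro sum.group) auto
  also have "\<dots> = (\<Sum>x\<in>carrier G. f x * (\<Sum>z\<in>roots n \<one>. f (inv x \<otimes> z)))"
  proof (rule sum.cong[OF refl])
    fix x assume x: "x \<in> carrier G"
    have "f (inv z \<otimes> x) = f (inv x \<otimes> z)" if "z \<in> carrier G" for z
      using sym[of "inv x \<otimes> z"] x that by (simp add: inv_mult_group)
    then have "(\<Sum>y\<in>roots n (x [^] n). f y) = (\<Sum>z\<in>roots n \<one>. f (inv x \<otimes> z))"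
      by (subst sum.reindex_bij_betw[OF bij_betw_roots[OF x], symmetric]) simp
    then show "f x * (\<Sum>y\<in>roots n (x [^] n). f y) = f x * (\<Sum>z\<in>roots n \<one>. f (inv x \<otimes> z))"
      by simp
  qed
  also have "\<dots> = (\<Sum>z\<in>roots n \<one>. \<Sum>x\<in>carrier G. f x * f (inv x \<otimes> z))"
    unfolding sum_distrib_left by (rule sum.swap)
  also have "\<dots> = (\<Sum>z\<in>roots n \<one>. (if z = \<one> then a else 0) + b)"
    using sq by (intro sum.cong) auto
  also have "\<dots> = a + b * int (card (roots n \<one>))"
    using fin by (simp add: sum.distrib)
  finally show ?thesis .
qed

text \<open>When \<open>p\<close> divides \<open>a\<close>, the multiple of \<open>f\<close> in the
  root congruence vanishes modulo \<open>p\<close>, and the constant is a multiple of the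
  coefficient sum. A fibre of the power \<open>p ^ Suc j\<close> is a disjoint union of fibres of
  the p-th power, so that case suffices.\<close>

lemma prime_dvd_sum_roots:
  assumes fin: "finite (carrier G)"
    and sq: "\<And>z. z \<in> carrier G \<Longrightarrow>
      (\<Sum>x\<in>carrier G. f x * f (inv x \<otimes> z)) = (if z = \<one> then a else 0) + b"
    and p: "Factorial_Ring.prime p" "odd p" "int p dvd a" "int p dvd (\<Sum>x\<in>carrier G. f x)"
  shows "int p dvd (\<Sum>x\<in>roots (p ^ Suc j) c. f x)"
proof -
  have p3: "p \<ge> 3" using p(2) prime_ge_2_nat[OF p(1)] by (cases "p = 2") auto
  then have "(p - 1) div 2 \<noteq> 0" by simp
  then have "int p dvd a ^ ((p - 1) div 2)"
    using p(3) by (meson dvd_power dvd_trans neq0_conv)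
  obtain d where d: "(\<Sum>x\<in>carrier G. f x) dvd d" "\<And>y. y \<in> carrier G \<Longrightarrow>
      [(\<Sum>x\<in>roots p y. f x) = a ^ ((p - 1) div 2) * f y + d] (mod int p)"
    using sum_roots_prime_cong[OF fin sq p(1,2)] by blast
  have root: "int p dvd (\<Sum>x\<in>roots p y. f x)" if "y \<in> carrier G" for y
  proof -
    have "int p dvd a ^ ((p - 1) div 2) * f y + d"
      using d(1) p(4) \<open>int p dvd a ^ ((p - 1) div 2)\<close> dvd_trans by fastforce
    then show ?thesis using cong_dvd_iff[OF d(2)[OF that]] by simp
  qed
  have sub: "{x \<in> roots (p ^ Suc j) c. x [^] p = y} = roots p y" if "y \<in> roots (p ^ j) c" for y
    using that by (auto simp: nat_pow_pow)
  have "(\<Sum>x\<in>roots (p ^ Suc j) c. f x)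
      = (\<Sum>y\<in>roots (p ^ j) c. \<Sum>x | x \<in> roots (p ^ Suc j) c \<and> x [^] p = y. f x)"
    using fin by (intro sum.group[symmetric]) (auto simp: nat_pow_pow)
  also have "\<dots> = (\<Sum>y\<in>roots (p ^ j) c. \<Sum>x\<in>roots p y. f x)"
    by (intro sum.cong refl) (use sub in blast)
  also have "int p dvd \<dots>"
    using root by (auto intro: dvd_sum[of "roots (p ^ j) c"])
  finally show ?thesis .
qed

section \<open>The size of a fibre modulo p - 1\<close>

lemma funpow_nat_pow: "x \<in> carrier G \<Longrightarrow> ((\<lambda>x. x [^] (s::nat)) ^^ i) x = x [^] (s ^ i)"
  by (induction i) (simp_all add: nat_pow_pow mult.commute)

lemma nat_pow_eq_self_iff:
  assumes "x \<in> carrier G" "t > 0"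
  shows "x [^] (t::nat) = x \<longleftrightarrow> x [^] (t - 1) = \<one>"
proof -
  have "x [^] t = x [^] (t - 1) \<otimes> x" using assms(2) by (cases t) auto
  then show ?thesis using assms(1) by (metis l_cancel_one' nat_pow_closed m_comm)
qed

text \<open>Off the elements killed by \<open>m\<close>, the power map from
  \<open>exists_multiplier\<close> has only orbits of size p - 1. The number \<open>e\<close> counts
  the elements of \<open>D\<close> in the fibre killed by \<open>m\<close>; two of them would agree
  in their powers \<open>m\<close> and \<open>p ^ 3\<close>, which are coprime, and so
  coincide.\<close>

lemma card_pow_invariant_fibre:
  assumes fin: "finite (carrier G)" and ord: "order G = m * p ^ 3"
    and p: "Factorial_Ring.prime p" and m: "coprime m p" "m > 1"
    and D: "D \<subseteq> carrier G"
    and closed: "\<And>x s. \<lbrakk>x \<in> D; s > 0; [s = 1] (mod m); coprime s p\<rbrakk> \<Longrightarrow> x [^] (s::nat) \<in> D"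
  shows "\<exists>e\<in>{0, 1}. int (p - 1) dvd int (card (D \<inter> roots (p ^ 3) c)) - e"
proof -
  obtain s where s: "s > 0" "[s = 1] (mod m)" "[s ^ (p - 1) = 1] (mod p ^ 3)"
    "\<And>i. \<lbrakk>0 < i; i < p - 1\<rbrakk> \<Longrightarrow> \<not> [s ^ i = 1] (mod p)"
    using exists_multiplier[OF p m] by blast
  have p1: "p - 1 > 0" using prime_gt_1_nat[OF p] by simp
  have "[s ^ (p - 1) = 1] (mod p)"
    using s(3) by (rule cong_dvd_modulus_nat) simp
  then have "coprime (s ^ (p - 1)) p"
    by (rule cong_imp_coprime[OF cong_sym]) simp
  then have cop: "coprime s p" using p1 by simp
  define F where "F = D \<inter> roots (p ^ 3) c"
  define M where "M = roots m \<one>"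
  have FG: "F \<subseteq> carrier G" and finF: "finite F"
    using D fin finite_subset by (auto simp: F_def)
  have copm: "coprime m (p ^ 3)" using m by simp
  have fix_pow: "x [^] t = x" if "x \<in> carrier G" "x [^] n = \<one>" "[t = 1] (mod n)" "t > 0" for x and n t :: nat
  proof -
    have "n dvd t - 1" using that cong_altdef_nat[of 1 t n] by simp
    then have "x [^] (t - 1) = \<one>" using that pow_eq_id dvd_trans by metis
    then show ?thesis using nat_pow_eq_self_iff that by blast
  qed
  have "int (p - 1) dvd (\<Sum>x\<in>F - M. 1)"
  proof (rule dvd_sum_free_orbits[where f = "\<lambda>x. x [^] s"])
    fix x assume x: "x \<in> F - M"
    then have xG: "x \<in> carrier G" and xD: "x \<in> D" and xc: "x [^] (p ^ 3) = c"
      using FG by (auto simp: F_def)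
    have ordx: "x [^] (m * p ^ 3) = \<one>" using pow_order_eq_1[OF xG] ord by simp
    have "[s ^ (p - 1) = 1] (mod m * p ^ 3)"
      using s(2,3) copm by (metis cong_pow coprime_cong_mult_nat power_one)
    then show "((\<lambda>x. x [^] s) ^^ (p - 1)) x = x"
      using fix_pow[OF xG ordx] s(1) by (simp add: funpow_nat_pow xG)
    show "((\<lambda>x. x [^] s) ^^ i) x \<noteq> x" if i: "0 < i" "i < p - 1" for i
    proof
      assume "((\<lambda>x. x [^] s) ^^ i) x = x"
      then have "x [^] (s ^ i - 1) = \<one>"
        using nat_pow_eq_self_iff[OF xG, of "s ^ i"] s(1) by (simp add: funpow_nat_pow xG)
      \<comment> \<open>Raising to the power \<open>m\<close> leaves an element of p-power order,
        while s^i - 1 is prime to \<open>p\<close>; so a fixed point must be killed by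
        \<open>m\<close>.\<close>
      then have "(x [^] m) [^] (s ^ i - 1) = \<one>"
        using xG by (metis mult.commute nat_pow_one nat_pow_pow)
      moreover have "(x [^] m) [^] (p ^ 3) = \<one>" using xG ordx by (simp add: nat_pow_pow)
      moreover have "coprime (s ^ i - 1) (p ^ 3)"
      proof -
        have "\<not> p dvd s ^ i - 1" using s(4)[OF i] s(1) cong_altdef_nat[of 1 "s ^ i" p] by simp
        then show ?thesis using p by (simp add: coprime_commute prime_imp_coprime)
      qed
      ultimately have "x [^] m = \<one>"
        using nat_pow_coprime_eq_one[of "x [^] m" "s ^ i - 1" "p ^ 3"] xG by blast
      then show False using x xG by (simp add: M_def)
    qed
    show "x [^] s \<in> F - M"
    proof -
      \<comment> \<open>The base point has order dividing \<open>m\<close> and \<open>s\<close> is 1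
        modulo \<open>m\<close>, so the power map fixes \<open>c\<close> and preserves its
        fibre.\<close>
      have "c [^] m = \<one>" using xc ordx xG by (auto simp: nat_pow_pow mult.commute)
      then have "c [^] s = c" using fix_pow[of c m s] s xc xG by auto
      then have "(x [^] s) [^] (p ^ 3) = c"
        using xc xG by (metis mult.commute nat_pow_pow)
      moreover have "x [^] s \<notin> M"
      proof
        assume "x [^] s \<in> M"
        then have "(x [^] m) [^] s = \<one>" using xG by (simp add: M_def nat_pow_pow mult.commute)
        moreover have "(x [^] m) [^] (p ^ 3) = \<one>" using xG ordx by (simp add: nat_pow_pow)
        ultimately have "x [^] m = \<one>"
          using nat_pow_coprime_eq_one[of "x [^] m" s "p ^ 3"] xG cop by simp
        then show False using x xG by (simp add: M_def)
      qed
      ultimately show ?thesis using closed[OF xD s(1,2) cop] xG by (simp add: F_def)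
    qed
  qed (use finF p1 in auto)
  then have dvd: "int (p - 1) dvd int (card (F - M))" by simp
  have uniq: "x = y" if "x \<in> F \<inter> M" "y \<in> F \<inter> M" for x y
    using that nat_pow_coprime_inj[OF _ _ _ _ copm, of x y] by (auto simp: F_def M_def)
  have "card (F \<inter> M) \<le> 1"
    using uniq by (metis One_nat_def card_le_Suc0_iff_eq finF finite_Int)
  moreover have "card F = card (F - M) + card (F \<inter> M)"
    using finF by (metis add.commute card_Int_Diff)
  ultimately show ?thesis
    using dvd unfolding F_def[symmetric]
    by (intro bexI[of _ "int (card (F \<inter> M))"]) auto
qed

end

section \<open>Eight fibre sums and the contradiction\<close>

theorem theorem2:
  fixes p :: nat and G :: "('a, 'b) monoid_scheme"
  assumes "Factorial_Ring.prime p" and "p \<ge> 5" and "comm_group G"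
  shows "\<not> (\<exists>D. partial_difference_set G (8 * p ^ 3) (4 * p ^ 2 + 2 * p + 1) (2 * p + 4) (2 * p + 2) D
               \<and> regular_subset G D)"
proof
  assume "\<exists>D. partial_difference_set G (8 * p ^ 3) (4 * p ^ 2 + 2 * p + 1) (2 * p + 4) (2 * p + 2) D
               \<and> regular_subset G D"
  then obtain D where pds0: "partial_difference_set G (8 * p ^ 3) (4 * p ^ 2 + 2 * p + 1)
      (2 * p + 4) (2 * p + 2) D"
    and reg: "regular_subset G D" by blast
  interpret comm_group G by fact
  let ?k = "4 * p ^ 2 + 2 * p + 1"
  let ?E = "pds_elem D"
  have pds: "partial_difference_set G (8 * p ^ 3) ?k ((2 * p + 2) + 2) (2 * p + 2) D"
    using pds0 by (simp add: numeral_eq_Suc)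
  have fin: "finite (carrier G)" and DG: "D \<subseteq> carrier G" and card: "card D = ?k"
    and ord: "order G = 8 * p ^ 3"
    using pds by (auto simp: partial_difference_set_def)
  have one: "\<one>\<^bsub>G\<^esub> \<notin> D" and invD: "\<And>x. x \<in> D \<Longrightarrow> inv\<^bsub>G\<^esub> x \<in> D"
    using reg by (auto simp: regular_subset_def)
  have oddp: "odd p" using assms(1,2) prime_odd_nat by auto
  have cop8: "coprime 8 p"
    using oddp coprime_power_left_iff[of 2 3 p] by simp
  have r: "int ?k + 1 - int (2 * p + 2) = (2 * int p)\<^sup>2"
    by (simp add: power2_eq_square)
  have sq: "(\<Sum>x\<in>carrier G. ?E x * ?E (inv\<^bsub>G\<^esub> x \<otimes>\<^bsub>G\<^esub> z))
      = (if z = \<one>\<^bsub>G\<^esub> then (2 * int p)\<^sup>2 else 0) + (2 * int p + 2)" if "z \<in> carrier G" for z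
    using pds_elem_square[OF pds reg that] r by simp
  have sumE: "(\<Sum>x\<in>carrier G. ?E x) = 2 * int p * (2 * int p + 1)"
    using sum_pds_elem[OF pds subset_refl] card DG
    by (simp add: Int_absorb2 power2_eq_square algebra_simps)
  have symE: "?E (inv\<^bsub>G\<^esub> x) = ?E x" if "x \<in> carrier G" for x
    using invD[of x] invD[of "inv\<^bsub>G\<^esub> x"] that by (auto simp: pds_elem_def)
  define A where "A = (\<lambda>x. x [^]\<^bsub>G\<^esub> (p ^ 3)) ` carrier G"
  define C where "C = (\<lambda>a. \<Sum>x\<in>roots (p ^ 3) a. ?E x)"
  have cards: "card A = 8" "card (roots (p ^ 3) \<one>\<^bsub>G\<^esub>) = p ^ 3"
    using card_pow_prime_power[OF fin, of 2 3 p 3] ord assms(1,2) by (auto simp: A_def)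
  have finA: "finite A" using fin by (simp add: A_def)
  have sumC: "(\<Sum>a\<in>A. C a) = 2 * int p * (2 * int p + 1)"
    unfolding A_def C_def sumE[symmetric] using fin by (intro sum.group) auto
  have sumC2: "(\<Sum>a\<in>A. (C a)\<^sup>2) = (2 * int p)\<^sup>2 + (2 * int p + 2) * int p ^ 3"
    unfolding A_def C_def using sum_roots_squares[OF fin sq symE, of "p ^ 3"] cards by simp
  \<comment> \<open>The shift p^2 makes all terms of degree 3 and 4 in p cancel, leaving 16 p^2.
    This is the sum of eight odd squares scaled by p^2, which avoids dividing \<open>C a\<close> by
    p.\<close>
  have "(\<Sum>a\<in>A. (2 * C a - (int p)\<^sup>2)\<^sup>2)
      = (\<Sum>a\<in>A. 4 * (C a)\<^sup>2 - 4 * (int p)\<^sup>2 * C a + int p ^ 4)"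
    by (intro sum.cong refl) (simp add: power2_eq_square power4_eq_xxxx algebra_simps)
  also have "\<dots> = 4 * (\<Sum>a\<in>A. (C a)\<^sup>2) - 4 * (int p)\<^sup>2 * (\<Sum>a\<in>A. C a) + 8 * int p ^ 4"
    using cards by (simp add: sum.distrib sum_subtractf sum_distrib_left)
  also have "\<dots> = 16 * (int p)\<^sup>2"
    unfolding sumC sumC2 by (simp add: power2_eq_square power3_eq_cube power4_eq_xxxx algebra_simps)
  finally have total: "(\<Sum>a\<in>A. (2 * C a - (int p)\<^sup>2)\<^sup>2) = 16 * (int p)\<^sup>2" .
  \<comment> \<open>The fibre over the identity is left out: it contains the identity, whose
    coefficient -1 makes the fibre sum differ from a count of elements of \<open>D\<close>.\<close>
  have big: "9 * (int p)\<^sup>2 \<le> (2 * C a - (int p)\<^sup>2)\<^sup>2" if a: "a \<in> A - {\<one>\<^bsub>G\<^esub>}" for a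
  proof -
    \<comment> \<open>Such exponents are odd and prime to \<open>p\<close>, hence prime to
      \<open>2 * order G\<close> and to r = 2p.\<close>
    have "x [^]\<^bsub>G\<^esub> s \<in> D" if "x \<in> D" "s > 0" "[s = 1] (mod 8)" "coprime s p" for x s
    proof (rule pds_pow_closed[OF pds reg r])
      have "coprime s 8" using that(3) by (metis cong_imp_coprime cong_sym coprime_1_left)
      then have "coprime s 2" by (rule coprime_divisors[rotated 2]) auto
      then show "coprime s (2 * order G)" "coprime (int s) (2 * int p)"
        using that \<open>coprime s 8\<close> coprime_int_iff[of s 2]
        unfolding ord coprime_mult_right_iff by auto
    qed (use that in auto)
    then have "\<exists>e\<in>{0, 1}. int (p - 1) dvd int (card (D \<inter> roots (p ^ 3) a)) - e"
      by (intro card_pow_invariant_fibre[OF fin ord assms(1) cop8 _ DG]) auto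
    then obtain e where e: "e \<in> {0, 1}" "int (p - 1) dvd int (card (D \<inter> roots (p ^ 3) a)) - e"
      by blast
    moreover have "C a = int (card (D \<inter> roots (p ^ 3) a))"
      unfolding C_def using sum_pds_elem[OF pds, of "roots (p ^ 3) a"] a by auto
    moreover have "int p dvd C a"
      unfolding C_def using prime_dvd_sum_roots[OF fin sq assms(1) oddp, of 2 a] sumE
      by (simp add: numeral_eq_Suc power2_eq_square)
    ultimately show ?thesis
      using odd_multiple_square_ge[of "int p" "C a" e] oddp assms(2) by (simp add: of_nat_diff)
  qed
  \<comment> \<open>Seven fibres already contribute 63 p^2, more than the total 16 p^2.\<close>
  have "card (A - {\<one>\<^bsub>G\<^esub>}) \<ge> 7" using cards finA by (simp add: card_Diff_singleton_if)
  then have "7 * (9 * (int p)\<^sup>2) \<le> int (card (A - {\<one>\<^bsub>G\<^esub>})) * (9 * (int p)\<^sup>2)"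
    by (intro mult_right_mono) auto
  also have "\<dots> \<le> (\<Sum>a\<in>A - {\<one>\<^bsub>G\<^esub>}. (2 * C a - (int p)\<^sup>2)\<^sup>2)"
    using big by (intro sum_bounded_below) auto
  also have "\<dots> \<le> (\<Sum>a\<in>A. (2 * C a - (int p)\<^sup>2)\<^sup>2)"
    using finA by (intro sum_mono2) auto
  finally have "63 * (int p)\<^sup>2 \<le> 16 * (int p)\<^sup>2" unfolding total by simp
  moreover have "(int p)\<^sup>2 > 0" using assms(2) by simp
  ultimately show False by linarith
qed

end
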